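(* Let $(A,\mu_k)$ be an $A_\infty$-algebra and $R$ a Rota-Baxter operator on it. Then $(A,\mu_{k,[r]})$ is a $\mathrm{Dend}_\infty$-algebra, where $$\mu_{k,[r]}(a_1,\ldots,a_k)=\mu_k(R(a_1),\ldots,R(a_{r-1}),a_r,R(a_{r+1}),\ldots,R(a_k)),\qquad k\ge1,\ 1\le r\le k.$$
   Context: $\mathbb{K}$ is a field of characteristic $0$. An $A_\infty$-algebra is a graded vector space $A$ with multilinear maps $\mu_k:A^{\otimes k}\to A$ ($k\ge1$) of degree $k-2$ such that for all $n\ge1$ and homogeneous $a_1,\ldots,a_n\in A$, $$\sum_{i+j=n+1}\sum_{\lambda=1}^j(-1)^{\lambda(i+1)+i(|a_1|+\cdots+|a_{\lambda-1}|)}\mu_j\big(a_1,\ldots,a_{\lambda-1},\mu_i(a_\lambda,\ldots,a_{\lambda+i-1}),a_{\lambda+i},\ldots,a_n\big)=0.$$ A Rota-Baxter operator on an $A_\infty$-algebra $(A,\mu_k)$ is a degree zero linear map $R:A\to A$ such that for all $k\ge1$ and $a_1,\ldots,a_k\in A$, $$\mu_k(R(a_1),\ldots,R(a_k))=R\Big(\sum_{i=1}^k\mu_k(R(a_1),\ldots,R(a_{i-1}),a_i,R(a_{i+1}),\ldots,R(a_k))\Big).$$ $C_n=\{[1],\ldots,[n]\}$ is a set of $n$ symbols, $\mathbb{K}[C_n]$ the vector space with basis $C_n$. For $1\le \lambda\le j$, $i\ge 1$: $R_0^{j,i,\lambda}:C_{i+j-1}\to C_j$ sends $[r]$ to $[r]$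 if $r\le\lambda-1$, to $[\lambda]$ if $\lambda\le r\le\lambda+i-1$, to $[r-i+1]$ if $r\ge\lambda+i$; $R^{j,i,\lambda}:C_{i+j-1}\to\mathbb{K}[C_i]$ sends $[r]$ to $[r-\lambda+1]$ if $\lambda\le r\le\lambda+i-1$ and to $[1]+\cdots+[i]$ otherwise. The notation $\mu_{k,x}$ is extended linearly to $x\in\mathbb{K}[C_k]$. A $\mathrm{Dend}_\infty$-algebra is a graded vector space $A=\oplus A_i$ with multilinear maps $\mu_{k,[r]}:A^{\otimes k}\to A$ ($[r]\in C_k$, $k\ge1$) of degree $k-2$ such that for all $n\ge1$, $[r]\in C_n$ and homogeneous $a_1,\ldots,a_n\in A$, $$\sum_{i+j=n+1}\sum_{\lambda=1}^j(-1)^{\lambda(i+1)+i(|a_1|+\cdots+|a_{\lambda-1}|)}\mu_{j,R_0^{j,i,\lambda}[r]}\big(a_1,\ldots,a_{\lambda-1},\mu_{i,R^{j,i,\lambda}[r]}(a_\lambda,\ldots,a_{\lambda+i-1}),a_{\lambda+i},\ldots,a_n\big)=0.$$ *)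

theory Defs
  imports Complex_Main "HOL-Library.Poly_Mapping"
begin

section \<open>Graded vector spaces and multilinear operations\<close>

text \<open>A \<open>\<int>\<close>-graded vector space is given as an internal direct sum of subspaces \<open>G d\<close>; as
  usual, the zero vector is homogeneous of every degree.\<close>

locale graded_vector_space = vector_space scale
  for scale :: "'k::field_char_0 \<Rightarrow> 'a::ab_group_add \<Rightarrow> 'a" +
  fixes G :: "int \<Rightarrow> 'a set"
  assumes subspace_component: "\<And>d. subspace (G d)"
    and direct_sum:
      "\<And>x. \<exists>!c. (\<forall>d. c d \<in> G d) \<and> finite {d. c d \<noteq> 0} \<and> x = (\<Sum>d | c d \<noteq> 0. c d)"

definition homogeneous :: "(int \<Rightarrow> 'a set) \<Rightarrow> 'a list \<Rightarrow> int list \<Rightarrow> bool" where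
  "homogeneous G as ds \<longleftrightarrow> list_all2 (\<lambda>a d. a \<in> G d) as ds"

text \<open>An operation \<open>A\<^sup>k \<rightarrow> A\<close> is a function on lists, of which only the values on lists of length \<open>k\<close>
  matter.\<close>

definition multilinear_op ::
  "('k::field \<Rightarrow> 'a::ab_group_add \<Rightarrow> 'a) \<Rightarrow> nat \<Rightarrow> ('a list \<Rightarrow> 'a) \<Rightarrow> bool" where
  "multilinear_op scale k f \<longleftrightarrow>
     (\<forall>as l. length as = k \<longrightarrow> l < k \<longrightarrow> Vector_Spaces.linear scale scale (\<lambda>x. f (as[l := x])))"

definition op_of_degree :: "(int \<Rightarrow> 'a set) \<Rightarrow> nat \<Rightarrow> int \<Rightarrow> ('a list \<Rightarrow> 'a) \<Rightarrow> bool" where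
  "op_of_degree G k e f \<longleftrightarrow>
     (\<forall>as ds. length as = k \<longrightarrow> homogeneous G as ds \<longrightarrow> f as \<in> G (sum_list ds + e))"

text \<open>With 1-based positions,
  \<open>contract f i l [a\<^sub>1, \<dots>, a\<^sub>n] = [a\<^sub>1, \<dots>, a\<^bsub>l-1\<^esub>, f [a\<^sub>l, \<dots>, a\<^bsub>l+i-1\<^esub>], a\<^bsub>l+i\<^esub>, \<dots>, a\<^sub>n]\<close>.\<close>

definition contract :: "('a list \<Rightarrow> 'a) \<Rightarrow> nat \<Rightarrow> nat \<Rightarrow> 'a list \<Rightarrow> 'a list" where
  "contract f i l as = take (l - 1) as @ [f (take i (drop (l - 1) as))] @ drop (l - 1 + i) as"

text \<open>Degrees may be negative, hence the integer exponent.\<close>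

definition ainf_sign :: "nat \<Rightarrow> nat \<Rightarrow> int list \<Rightarrow> 'k::field" where
  "ainf_sign i l ds = (- 1) powi (int l * (int i + 1) + int i * sum_list (take (l - 1) ds))"


section \<open>\<open>A\<^sub>\<infinity>\<close>-algebras and Rota-Baxter operators\<close>

locale A_infinity_algebra = graded_vector_space scale G
  for scale :: "'k::field_char_0 \<Rightarrow> 'a::ab_group_add \<Rightarrow> 'a" and G :: "int \<Rightarrow> 'a set" +
  fixes \<mu> :: "nat \<Rightarrow> 'a list \<Rightarrow> 'a"
  assumes multilinear: "\<And>k. k \<ge> 1 \<Longrightarrow> multilinear_op scale k (\<mu> k)"
    and degree: "\<And>k. k \<ge> 1 \<Longrightarrow> op_of_degree G k (int k - 2) (\<mu> k)"
    and relation: "\<And>n as ds. n \<ge> 1 \<Longrightarrow> length as = n \<Longrightarrow> homogeneous G as ds \<Longrightarrow>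
      (\<Sum>(i, j) \<in> {(i, j). i \<ge> 1 \<and> j \<ge> 1 \<and> i + j = n + 1}. \<Sum>l = 1..j.
         scale (ainf_sign i l ds) (\<mu> j (contract (\<mu> i) i l as))) = 0"

text \<open>\<open>map_except R r [a\<^sub>1, \<dots>, a\<^sub>k] = [R a\<^sub>1, \<dots>, R a\<^bsub>r-1\<^esub>, a\<^sub>r, R a\<^bsub>r+1\<^esub>, \<dots>, R a\<^sub>k]\<close>, with 1-based \<open>r\<close>.\<close>

definition map_except :: "('a \<Rightarrow> 'a) \<Rightarrow> nat \<Rightarrow> 'a list \<Rightarrow> 'a list" where
  "map_except R r as = map R (take (r - 1) as) @ [as ! (r - 1)] @ map R (drop r as)"

locale Rota_Baxter_operator = A_infinity_algebra scale G \<mu>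
  for scale :: "'k::field_char_0 \<Rightarrow> 'a::ab_group_add \<Rightarrow> 'a" and G :: "int \<Rightarrow> 'a set"
    and \<mu> :: "nat \<Rightarrow> 'a list \<Rightarrow> 'a" +
  fixes R :: "'a \<Rightarrow> 'a"
  assumes R_linear: "Vector_Spaces.linear scale scale R"
    and R_degree_zero: "\<And>d a. a \<in> G d \<Longrightarrow> R a \<in> G d"
    and Rota_Baxter: "\<And>k as. k \<ge> 1 \<Longrightarrow> length as = k \<Longrightarrow>
      \<mu> k (map R as) = R (\<Sum>i = 1..k. \<mu> k (map_except R i as))"


section \<open>\<open>Dend\<^sub>\<infinity>\<close>-algebras\<close>

text \<open>The symbol \<open>[r] \<in> C\<^sub>n\<close> is encoded as the number \<open>r \<in> {1..n}\<close>, and \<open>\<K>[C\<^sub>n]\<close> as the finitely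
  supported functions on \<open>nat\<close> with support in \<open>C n\<close>, the basis vector \<open>[r]\<close> being \<open>single r 1\<close>.\<close>

definition C :: "nat \<Rightarrow> nat set" where
  "C n = {1..n}"

definition R0_map :: "nat \<Rightarrow> nat \<Rightarrow> nat \<Rightarrow> nat \<Rightarrow> nat" where
  "R0_map j i l r = (if r \<le> l - 1 then r else if r \<le> l + i - 1 then l else r - i + 1)"

definition R_map :: "nat \<Rightarrow> nat \<Rightarrow> nat \<Rightarrow> nat \<Rightarrow> (nat \<Rightarrow>\<^sub>0 'k::field)" where
  "R_map j i l r =
     (if l \<le> r \<and> r \<le> l + i - 1 then Poly_Mapping.single (r - l + 1) 1
      else (\<Sum>s \<in> C i. Poly_Mapping.single s 1))"

definition linear_extension ::
  "('k::field \<Rightarrow> 'a::ab_group_add \<Rightarrow> 'a) \<Rightarrow> (nat \<Rightarrow> 'a list \<Rightarrow> 'a) \<Rightarrow> (nat \<Rightarrow>\<^sub>0 'k) \<Rightarrow> 'a list \<Rightarrow> 'a" where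
  "linear_extension scale f x as =
     (\<Sum>s \<in> Poly_Mapping.keys x. scale (Poly_Mapping.lookup x s) (f s as))"

locale Dend_infinity_algebra = graded_vector_space scale G
  for scale :: "'k::field_char_0 \<Rightarrow> 'a::ab_group_add \<Rightarrow> 'a" and G :: "int \<Rightarrow> 'a set" +
  fixes \<mu> :: "nat \<Rightarrow> nat \<Rightarrow> 'a list \<Rightarrow> 'a"
  assumes multilinear: "\<And>k r. k \<ge> 1 \<Longrightarrow> r \<in> C k \<Longrightarrow> multilinear_op scale k (\<mu> k r)"
    and degree: "\<And>k r. k \<ge> 1 \<Longrightarrow> r \<in> C k \<Longrightarrow> op_of_degree G k (int k - 2) (\<mu> k r)"
    and relation: "\<And>n r as ds. n \<ge> 1 \<Longrightarrow> r \<in> C n \<Longrightarrow> length as = n \<Longrightarrow> homogeneous G as ds \<Longrightarrow>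
      (\<Sum>(i, j) \<in> {(i, j). i \<ge> 1 \<and> j \<ge> 1 \<and> i + j = n + 1}. \<Sum>l = 1..j.
         scale (ainf_sign i l ds)
           (\<mu> j (R0_map j i l r) (contract (linear_extension scale (\<mu> i) (R_map j i l r)) i l as))) = 0"

end

theory Submission
  imports Defs
begin

text \<open>The \<open>Dend\<^sub>\<infinity>\<close>-relation for \<open>[r]\<close> and \<open>a\<^sub>1, \<dots>, a\<^sub>n\<close> is, summand by summand, the
  \<open>A\<^sub>\<infinity>\<close>-relation for the arguments \<open>R a\<^sub>1, \<dots>, a\<^sub>r, \<dots>, R a\<^sub>n\<close>, which have the same degrees and
  hence the same signs (\<open>map_except_contract\<close>). Indeed, the inner operation acts on the block of
  arguments \<open>l, \<dots>, l + i - 1\<close>. If position \<open>r\<close> lies in the block, then the outer operation leaves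
  the result of the inner one alone and the inner one leaves \<open>a\<^sub>r\<close> alone. Otherwise the inner
  operation is the sum of all \<open>\<mu>\<^bsub>i,[s]\<^esub>\<close> and the outer operation applies \<open>R\<close> to it; by the
  Rota-Baxter identity this is \<open>\<mu>\<^sub>i\<close> of the block with \<open>R\<close> applied to every entry.\<close>

lemma map_except_append1:
  assumes "1 \<le> r" "r \<le> length xs"
  shows "map_except R r (xs @ ys) = map_except R r xs @ map R ys"
proof -
  have "r - 1 < length xs"
    using assms by linarith
  with assms show ?thesis
    by (simp add: map_except_def nth_append)
qed

lemma map_except_append2:
  assumes "length xs < r"
  shows "map_except R r (xs @ ys) = map R xs @ map_except R (r - length xs) ys"
proof -
  have "\<not> r - 1 < length xs"
    using assms by linarith
  with assms show ?thesis
    by (simp add: map_except_def nth_append)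
qed

lemma map_except_Cons_1: "map_except R (Suc 0) (x # xs) = x # map R xs"
  by (simp add: map_except_def)

lemma map_except_eq_list_update:
  assumes "1 \<le> r" "r \<le> length as"
  shows "map_except R r as = (map R as)[r - 1 := as ! (r - 1)]"
  using assms by (simp add: map_except_def upd_conv_take_nth_drop take_map drop_map)

lemma length_map_except:
  assumes "1 \<le> r" "r \<le> length as"
  shows "length (map_except R r as) = length as"
  using assms by (simp add: map_except_eq_list_update)

lemma map_except_list_update:
  assumes "1 \<le> r" "r \<le> length as" "l < length as"
  shows "map_except R r (as[l := x]) = (map_except R r as)[l := (if l = r - 1 then x else R x)]"
  using assms by (auto simp: map_except_eq_list_update map_update list_update_swap)

lemma homogeneous_map_except:
  assumes "homogeneous G as ds" "1 \<le> r" "r \<le> length as"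
    and "\<And>d a. a \<in> G d \<Longrightarrow> R a \<in> G d"
  shows "homogeneous G (map_except R r as) ds"
  using assms
  by (auto simp: homogeneous_def list_all2_conv_all_nth map_except_eq_list_update nth_list_update)

lemma contract_append:
  assumes "l = length xs + 1" "i = length ys"
  shows "contract f i l (xs @ ys @ zs) = xs @ f ys # zs"
  using assms by (simp add: contract_def)

lemma (in vector_space) linear_extension_single:
  "linear_extension scale f (Poly_Mapping.single s 1) as = f s as"
  by (simp add: linear_extension_def)

lemma (in vector_space) linear_extension_sum_single:
  assumes "finite S"
  shows "linear_extension scale f (\<Sum>s\<in>S. Poly_Mapping.single s 1) as = (\<Sum>s\<in>S. f s as)"
proof -
  let ?x = "\<Sum>s\<in>S. Poly_Mapping.single s (1 :: 'a)"
  have lookup: "Poly_Mapping.lookup ?x s = (if s \<in> S then 1 else 0)" for s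
    using assms by (simp add: lookup_sum lookup_single when_def)
  have "Poly_Mapping.keys ?x = S"
    by (auto simp: in_keys_iff lookup split: if_splits)
  then show ?thesis
    by (simp add: linear_extension_def lookup)
qed

context Rota_Baxter_operator
begin

text \<open>The Rota-Baxter identity in terms of the operation \<open>\<mu>\<^bsub>i,[1] + \<dots> + [i]\<^esub>\<close>.\<close>

lemma R_linear_extension_all:
  assumes "k \<ge> 1" "length as = k"
  shows "R (linear_extension scale (\<lambda>s as. \<mu> k (map_except R s as))
            (\<Sum>s\<in>C k. Poly_Mapping.single s 1) as) = \<mu> k (map R as)"
  using Rota_Baxter[OF assms] by (simp add: linear_extension_sum_single C_def)

lemma map_except_contract:
  assumes "i \<ge> 1" "1 \<le> l" "l \<le> j" "i + j = length as + 1" "1 \<le> r" "r \<le> length as"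
  shows "map_except R (R0_map j i l r)
           (contract (linear_extension scale (\<lambda>s as. \<mu> i (map_except R s as)) (R_map j i l r)) i l as)
       = contract (\<mu> i) i l (map_except R r as)"
proof -
  define xs ys zs where "xs = take (l - 1) as" and "ys = take i (drop (l - 1) as)"
    and "zs = drop (l - 1 + i) as"
  have as: "as = xs @ ys @ zs"
    unfolding xs_def ys_def zs_def
    by (metis add.commute append_take_drop_id drop_drop)
  have l: "l = length xs + 1" and i: "i = length ys"
    using assms by (auto simp: xs_def ys_def)
  let ?f = "linear_extension scale (\<lambda>s as. \<mu> i (map_except R s as)) (R_map j i l r)"
  have contr: "contract ?f i l as = xs @ ?f ys # zs"
    unfolding as by (rule contract_append[OF l i])
  have R_f: "R (?f ys) = \<mu> i (map R ys)" if "r < l \<or> l + i \<le> r"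
  proof -
    have "R_map j i l r = (\<Sum>s\<in>C i. Poly_Mapping.single s (1 :: 'k))"
      using that assms by (auto simp: R_map_def)
    then show ?thesis
      using R_linear_extension_all[OF assms(1) i[symmetric]] by simp
  qed
  consider "r < l" | "l \<le> r" "r < l + i" | "l + i \<le> r"
    by linarith
  then show ?thesis
  proof cases
    case 1
    have r: "r \<le> length xs"
      using 1 l by simp
    have "contract (\<mu> i) i l (map_except R r as)
        = map_except R r xs @ \<mu> i (map R ys) # map R zs"
      using 1 assms l i length_map_except[of r xs R]
      by (simp add: as map_except_append1 contract_append)
    moreover have "R0_map j i l r = r"
      using 1 by (auto simp: R0_map_def)
    ultimately show ?thesis
      using 1 assms(5) r by (simp add: contr map_except_append1 R_f)
  next
    case 2
    have "length xs < l" "l - length xs = Suc 0"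
      using l by simp_all
    moreover have "?f ys = \<mu> i (map_except R (r - length xs) ys)"
    proof -
      have "r - l + 1 = r - length xs"
        using 2 l by linarith
      moreover have "R_map j i l r = Poly_Mapping.single (r - l + 1) (1 :: 'k)"
        using 2 by (auto simp: R_map_def)
      ultimately show ?thesis
        by (simp only: linear_extension_single)
    qed
    moreover have "contract (\<mu> i) i l (map_except R r as)
        = map R xs @ \<mu> i (map_except R (r - length xs) ys) # map R zs"
      using 2 assms l i length_map_except[of "r - length xs" ys R]
      by (simp add: as map_except_append1 map_except_append2 contract_append)
    moreover have "R0_map j i l r = l"
      using 2 assms by (auto simp: R0_map_def)
    ultimately show ?thesis
      by (simp add: contr map_except_append2 map_except_Cons_1)
  next
    case 3
    have "contract (\<mu> i) i l (map_except R r as)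
        = map R xs @ \<mu> i (map R ys) # map_except R (r - length xs - length ys) zs"
      using 3 assms l i
      by (simp add: as map_except_append2 contract_append)
    moreover have "R0_map j i l r = r - i + 1"
      using 3 assms by (auto simp: R0_map_def)
    moreover have "map_except R (r - i + 1) ((xs @ [?f ys]) @ zs)
        = map R (xs @ [?f ys]) @ map_except R (r - i + 1 - length (xs @ [?f ys])) zs"
      using 3 l by (intro map_except_append2) simp
    moreover have "r - i + 1 - length (xs @ [?f ys]) = r - length xs - length ys"
      using 3 l i by simp
    ultimately show ?thesis
      using 3 by (simp add: contr R_f)
  qed
qed

lemma multilinear_map_except:
  assumes "1 \<le> r" "r \<le> k"
  shows "multilinear_op scale k (\<lambda>as. \<mu> k (map_except R r as))"
  unfolding multilinear_op_def
proof (intro allI impI)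
  fix as :: "'a list" and l
  assume len: "length as = k" and "l < k"
  let ?g = "\<lambda>x. \<mu> k ((map_except R r as)[l := x])"
  have lin: "Vector_Spaces.linear scale scale ?g"
    using multilinear[of k] assms len \<open>l < k\<close> length_map_except[of r as R]
    by (simp add: multilinear_op_def)
  have upd: "\<mu> k (map_except R r (as[l := x])) = ?g (if l = r - 1 then x else R x)" for x
    using assms len \<open>l < k\<close> by (simp add: map_except_list_update)
  show "Vector_Spaces.linear scale scale (\<lambda>x. \<mu> k (map_except R r (as[l := x])))"
  proof (cases "l = r - 1")
    case True
    then show ?thesis
      using lin unfolding upd by simp
  next
    case False
    then show ?thesis
      using Vector_Spaces.linear_compose[OF R_linear lin] unfolding upd by (simp add: o_def)
  qed
qed

end

theorem theorem5p2:
  fixes scale :: "'k::field_char_0 \<Rightarrow> 'a::ab_group_add \<Rightarrow> 'a"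
    and G :: "int \<Rightarrow> 'a set"
    and \<mu> :: "nat \<Rightarrow> 'a list \<Rightarrow> 'a"
    and R :: "'a \<Rightarrow> 'a"
  assumes "A_infinity_algebra scale G \<mu>"
    and "Rota_Baxter_operator scale G \<mu> R"
  shows "Dend_infinity_algebra scale G (\<lambda>k r as. \<mu> k (map_except R r as))"
proof -
  interpret Rota_Baxter_operator scale G \<mu> R
    by (fact assms(2))
  show ?thesis
  proof
    fix k r :: nat
    assume k: "k \<ge> 1" and r: "r \<in> C k"
    show "multilinear_op scale k (\<lambda>as. \<mu> k (map_except R r as))"
      using r by (intro multilinear_map_except) (auto simp: C_def)
    show "op_of_degree G k (int k - 2) (\<lambda>as. \<mu> k (map_except R r as))"
      using degree[OF k] r R_degree_zero homogeneous_map_except[of G _ _ r R]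
        length_map_except[of r _ R]
      by (simp add: op_of_degree_def C_def)
  next
    fix n r :: nat and as :: "'a list" and ds :: "int list"
    assume n: "n \<ge> 1" and r: "r \<in> C n" and len: "length as = n" and hom: "homogeneous G as ds"
    have term_eq: "map_except R (R0_map j i l r)
           (contract (linear_extension scale (\<lambda>s as. \<mu> i (map_except R s as)) (R_map j i l r)) i l as)
       = contract (\<mu> i) i l (map_except R r as)"
      if "i \<ge> 1" "i + j = n + 1" "l \<in> {1..j}" for i j l
      using that r len by (intro map_except_contract) (auto simp: C_def)
    have "(\<Sum>(i, j) \<in> {(i, j). i \<ge> 1 \<and> j \<ge> 1 \<and> i + j = n + 1}. \<Sum>l = 1..j.
         scale (ainf_sign i l ds) (\<mu> j (map_except R (R0_map j i l r)
           (contract (linear_extension scale (\<lambda>s as. \<mu> i (map_except R s as)) (R_map j i l r))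
             i l as))))
       = (\<Sum>(i, j) \<in> {(i, j). i \<ge> 1 \<and> j \<ge> 1 \<and> i + j = n + 1}. \<Sum>l = 1..j.
         scale (ainf_sign i l ds) (\<mu> j (contract (\<mu> i) i l (map_except R r as))))"
      unfolding case_prod_unfold
      by (intro sum.cong refl arg_cong[of _ _ "\<lambda>x. scale _ (\<mu> _ x)"] term_eq) auto
    also have "\<dots> = 0"
    proof (rule relation[OF n])
      show "length (map_except R r as) = n"
        using r len by (simp add: C_def length_map_except)
      show "homogeneous G (map_except R r as) ds"
        using r len by (intro homogeneous_map_except[OF hom]) (auto simp: C_def R_degree_zero)
    qed
    finally show "(\<Sum>(i, j) \<in> {(i, j). i \<ge> 1 \<and> j \<ge> 1 \<and> i + j = n + 1}. \<Sum>l = 1..j.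
         scale (ainf_sign i l ds) (\<mu> j (map_except R (R0_map j i l r)
           (contract (linear_extension scale (\<lambda>s as. \<mu> i (map_except R s as)) (R_map j i l r))
             i l as)))) = 0" .
  qed
qed

end
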